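(* Let $\lambda$ be a nonzero real (or complex) number and let $k\in\mathbb{Z}$. For every integer $n\ge 0$, $$\beta_{n,\lambda}^{(k)}=(-1)^{n}\sum_{m=0}^{n}\frac{\lambda^{m}(1)_{m+1,1/\lambda}}{(m+1)^{k}}S_{2,\lambda}(n,m).$$
   Context: All generating functions are formal power series. For nonzero $\lambda$, the degenerate exponential is $e_\lambda(t)=(1+\lambda t)^{1/\lambda}=\sum_{n\ge0}\binom{1/\lambda}{n}\lambda^n t^n$. For nonzero $\mu$, put $(1)_{0,\mu}=1$ and $(1)_{n,\mu}=(1-\mu)(1-2\mu)\cdots(1-(n-1)\mu)$ for $n\ge1$ (so $(1)_{1,\mu}=1$). The degenerate Stirling numbers of the second kind $S_{2,\lambda}(n,m)$ are defined, for each $m\ge0$, by $\frac{1}{m!}(e_{\lambda}(t)-1)^{m}=\sum_{n=m}^{\infty}S_{2,\lambda}(n,m)\frac{t^{n}}{n!}$. For $k\in\mathbb{Z}$ the degenerate polylogarithm function is $l_{k,\lambda}(x)=\sum_{n=1}^{\infty}\frac{(-\lambda)^{n-1}(1)_{n,1/\lambda}}{(n-1)!\,n^{k}}x^{n}$, and the degenerate poly-Bernoulli numbers $\beta_{n,\lambda}^{(k)}$ are defined by $$\frac{l_{k,\lambda}(1-e_{\lambda}(-t))}{1-e_{\lambda}(-t)}=\sum_{n=0}^{\infty}\beta_{n,\lambda}^{(k)}\frac{t^{n}}{n!},$$ i.e. by substituting $x=1-e_\lambda(-t)$ (which has zero constant term) into the power series $l_{k,\lambda}(x)/x$. *)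

theory Defs
  imports Complex_Main "HOL-Computational_Algebra.Formal_Power_Series"
begin

definition degen_exp :: "'a::field_char_0 \<Rightarrow> 'a fps" where
  "degen_exp lam = Abs_fps (\<lambda>n. ((1 / lam) gchoose n) * lam ^ n)"

definition degen_one :: "nat \<Rightarrow> 'a::field_char_0 \<Rightarrow> 'a" where
  "degen_one n mu = (\<Prod>i=1..<n. 1 - of_nat i * mu)"

definition degen_Stirling2 :: "'a::field_char_0 \<Rightarrow> nat \<Rightarrow> nat \<Rightarrow> 'a" where
  "degen_Stirling2 lam n m =
     fact n * fps_nth (fps_const (1 / fact m) * (degen_exp lam - 1) ^ m) n"

definition degen_polylog :: "int \<Rightarrow> 'a::field_char_0 \<Rightarrow> 'a fps" where
  "degen_polylog k lam = Abs_fps (\<lambda>n. if n = 0 then 0 else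
     (- lam) ^ (n - 1) * degen_one n (1 / lam) / (fact (n - 1) * of_nat n powi k))"

text \<open>Here \<open>degen_polylog k lam / fps_X\<close> is exact division, since the polylogarithm has no
  constant term; into this quotient we substitute \<open>x = 1 - degen_exp lam (-t)\<close>, whose constant
  term also vanishes.\<close>

definition degen_poly_Bernoulli :: "int \<Rightarrow> 'a::field_char_0 \<Rightarrow> nat \<Rightarrow> 'a" where
  "degen_poly_Bernoulli k lam n =
     fact n * fps_nth
       (fps_compose (degen_polylog k lam / fps_X) (1 - fps_compose (degen_exp lam) (- fps_X))) n"

text \<open>The numbers above are read off as coefficients; the following facts recover the
  generating-function identities that characterise them.\<close>

lemma degen_exp_conv_fps_binomial:
  "degen_exp lam = fps_compose (fps_binomial (1 / lam)) (fps_const lam * fps_X)"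
  by (simp add: degen_exp_def fps_eq_iff fps_compose_linear)

lemma degen_Stirling2_egf_from:
  assumes "n < m"
  shows "degen_Stirling2 lam n m = 0"
proof -
  have "fps_nth (degen_exp lam - 1) 0 = 0"
    by (simp add: degen_exp_def)
  then have "fps_nth ((degen_exp lam - 1) ^ m) n = 0"
    using assms startsby_zero_power_prefix by blast
  then show ?thesis
    by (simp add: degen_Stirling2_def)
qed

lemma degen_Stirling2_egf:
  "fps_const (1 / fact m) * (degen_exp lam - 1) ^ m =
     Abs_fps (\<lambda>n. degen_Stirling2 lam n m / fact n)"
  by (simp add: degen_Stirling2_def fps_eq_iff)

lemma degen_poly_Bernoulli_egf:
  fixes lam :: "'a::field_char_0"
  defines "u \<equiv> 1 - fps_compose (degen_exp lam) (- fps_X)"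
  assumes "lam \<noteq> 0"
  shows "fps_compose (degen_polylog k lam) u / u =
     Abs_fps (\<lambda>n. degen_poly_Bernoulli k lam n / fact n)"
proof -
  have u0: "fps_nth u 0 = 0"
    by (simp add: u_def degen_exp_def)
  have u1: "fps_nth u 1 = 1"
    using assms(2) by (simp add: u_def degen_exp_def fps_compose_uminus')
  then have u: "u \<noteq> 0"
    by auto
  define g where "g = degen_polylog k lam / fps_X"
  have "degen_polylog k lam = fps_shift 1 (degen_polylog k lam) * fps_X"
    by (simp add: fps_eq_iff degen_polylog_def)
  then have "degen_polylog k lam = g * fps_X"
    unfolding g_def by (metis fps_X_neq_zero nonzero_mult_div_cancel_right)
  then have "fps_compose (degen_polylog k lam) u = fps_compose g u * u"
    using u0 by (simp add: fps_compose_mult_distrib)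
  then have "fps_compose (degen_polylog k lam) u / u = fps_compose g u"
    using u by simp
  then show ?thesis
    by (simp add: fps_eq_iff degen_poly_Bernoulli_def g_def u_def)
qed

end

theory Submission
  imports Defs
begin

text \<open>Put u = 1 - e(-t), where e is \<open>degen_exp lam\<close>. The coefficient of t^n in
  the composite is the sum over m \<le> n of the m-th coefficient of l(x)/x times that of t^n in
  u^m. Since u is -(e - 1) evaluated at -t, its powers are signed generating functions of the
  Stirling numbers (\<open>degen_exp_reflect_power_nth\<close>).\<close>

lemma degen_polylog_div_X_nth:
  "fps_nth (degen_polylog k lam / fps_X) m =
     (- lam) ^ m * degen_one (m + 1) (1 / lam) / (fact m * of_nat (m + 1) powi k)"
proof -
  have "degen_polylog k lam = fps_shift 1 (degen_polylog k lam) * fps_X"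
    by (simp add: fps_eq_iff degen_polylog_def)
  then have "degen_polylog k lam / fps_X = fps_shift 1 (degen_polylog k lam)"
    by (metis fps_X_neq_zero nonzero_mult_div_cancel_right)
  then show ?thesis
    by (simp add: degen_polylog_def)
qed

text \<open>Pulling -1 out of the base contributes \<open>(- 1) ^ m\<close>; the substitution of -t
  for t contributes \<open>(- 1) ^ n\<close>.\<close>

lemma degen_exp_reflect_power_nth:
  "fps_nth ((1 - fps_compose (degen_exp lam) (- fps_X)) ^ m) n =
     (- 1) ^ (m + n) * fact m / fact n * degen_Stirling2 lam n m"
proof -
  have "1 - fps_compose (degen_exp lam) (- fps_X) =
      fps_const (- 1) * fps_compose (degen_exp lam - 1) (- fps_X)"
    by (simp add: fps_compose_sub_distrib flip: fps_const_neg)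
  then have "(1 - fps_compose (degen_exp lam) (- fps_X)) ^ m =
      fps_const ((- 1) ^ m) * fps_compose ((degen_exp lam - 1) ^ m) (- fps_X)"
    by (simp only: power_mult_distrib fps_const_power fps_compose_power)
      (simp add: fps_compose_power)
  then show ?thesis
    by (simp add: fps_compose_uminus' degen_Stirling2_def power_add)
qed

theorem theorem4:
  fixes lam :: "'a::real_normed_field" and k :: int and n :: nat
  assumes "lam \<noteq> 0"
  shows "degen_poly_Bernoulli k lam n =
    (-1) ^ n * (\<Sum>m=0..n. lam ^ m * degen_one (m + 1) (1 / lam) / of_nat (m + 1) powi k
                          * degen_Stirling2 lam n m)"
proof -
  \<comment> \<open>Termwise cancellation: \<open>(- 1) ^ m\<close> from the reflected power meets
    that in \<open>(- lam) ^ m\<close>, and both factorials drop out, leaving only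
    \<open>(- 1) ^ n\<close>.\<close>
  have "fact n * ((- lam) ^ m * c / (fact m * d) * ((- 1) ^ (m + n) * fact m / fact n * s)) =
      (- 1) ^ n * (lam ^ m * c / d * s)" for c d s :: 'a and m
    by (simp add: power_minus[of lam] power_add)
  then show ?thesis
    unfolding degen_poly_Bernoulli_def fps_compose_nth degen_polylog_div_X_nth
      degen_exp_reflect_power_nth sum_distrib_left
    by (intro sum.cong refl)
qed

end
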